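(* Let $F$ be an Orlicz function satisfying the $\Delta_2$-condition. If $F$ is elastic at $\infty$ then $F$ is equivalent to an Orlicz function which is regularly varying at $\infty$.
   Context: An Orlicz function is a continuous strictly increasing convex function $F:[0,\infty)\to[0,\infty)$ with $F(0)=0$. It satisfies the $\Delta_2$-condition if there is a constant $\Delta$ with $F(2x)\le\Delta F(x)$ for all $x\ge0$. Two Orlicz functions $F,G$ are equivalent if there is a constant $C\ge1$ with $F(x/C)\le G(x)\le F(Cx)$ for all $x\ge 0$. For $t>0$ put $F_t(x)=F(tx)/F(t)$. An Orlicz function $G$ is regularly varying at $\infty$ if $\lim_{t\to\infty}G(tx)/G(t)$ exists for all $x$ (equivalently, it equals $x^p$ for some $1\le p<\infty$). For $C>1$ and $0<x\le1$, let $\Phi_+^\infty(x,C)$ be the supremum of all $n$ such that there exist $1\le a_1<b_1\le a_2<b_2\le\cdots\le a_n<b_n$ with $F_{b_k}(x)\ge CF_{a_k}(x)$ for $1\le k\le n$; let $\Phi_-^\infty(x,C)$ be the supremum of all $n$ such that there exist $1\le a_1<b_1\le\cdots\le a_n<b_n$ with $F_{a_k}(x)\ge CF_{b_k}(x)$ for $1\le k\le n$. $F$ is elastic at $\infty$ if there exist $C_0,C_1>1$ and $r>0$ such that $\Phi_+^\infty(x,C_0)+\Phi_-^\infty(x,C_0)\le C_1x^{-r}$ for all $0<x\le1$. *)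

theory Defs
  imports "HOL-Analysis.Analysis"
begin

text \<open>Functions on \<open>[0,\<infinity>)\<close> are represented by total functions on the reals; every notion below
  depends only on the values at nonnegative arguments.\<close>

definition orlicz_function :: "(real \<Rightarrow> real) \<Rightarrow> bool" where
  "orlicz_function F \<longleftrightarrow>
     F ` {0..} \<subseteq> {0..} \<and> continuous_on {0..} F \<and> strict_mono_on {0..} F \<and>
     convex_on {0..} F \<and> F 0 = 0"

definition Delta2_condition :: "(real \<Rightarrow> real) \<Rightarrow> bool" where
  "Delta2_condition F \<longleftrightarrow> (\<exists>\<Delta>. \<forall>x\<ge>0. F (2 * x) \<le> \<Delta> * F x)"

definition orlicz_equivalent :: "(real \<Rightarrow> real) \<Rightarrow> (real \<Rightarrow> real) \<Rightarrow> bool" where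
  "orlicz_equivalent F G \<longleftrightarrow> (\<exists>C\<ge>1. \<forall>x\<ge>0. F (x / C) \<le> G x \<and> G x \<le> F (C * x))"

definition rescale :: "(real \<Rightarrow> real) \<Rightarrow> real \<Rightarrow> real \<Rightarrow> real" where
  "rescale F t x = F (t * x) / F t"

definition regularly_varying_at_infinity :: "(real \<Rightarrow> real) \<Rightarrow> bool" where
  "regularly_varying_at_infinity G \<longleftrightarrow>
     (\<forall>x\<ge>0. \<exists>l. ((\<lambda>t. G (t * x) / G t) \<longlongrightarrow> l) at_top)"

text \<open>The chains \<open>1 \<le> a\<^sub>1 < b\<^sub>1 \<le> a\<^sub>2 < b\<^sub>2 \<le> \<dots> \<le> a\<^sub>n < b\<^sub>n\<close>; only the indices \<open>1, \<dots>, n\<close>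
  matter, and there is no constraint when \<open>n = 0\<close>.\<close>

definition interval_chain :: "nat \<Rightarrow> (nat \<Rightarrow> real) \<Rightarrow> (nat \<Rightarrow> real) \<Rightarrow> bool" where
  "interval_chain n a b \<longleftrightarrow>
     (n \<ge> 1 \<longrightarrow> 1 \<le> a 1) \<and>
     (\<forall>k\<in>{1..n}. a k < b k) \<and>
     (\<forall>k\<in>{1..<n}. b k \<le> a (Suc k))"

text \<open>The suprema are taken in \<^typ>\<open>enat\<close>, since they may be infinite.\<close>

definition Phi_plus_infinity :: "(real \<Rightarrow> real) \<Rightarrow> real \<Rightarrow> real \<Rightarrow> enat" where
  "Phi_plus_infinity F x C =
     Sup {enat n | n. \<exists>a b. interval_chain n a b \<and>
       (\<forall>k\<in>{1..n}. rescale F (b k) x \<ge> C * rescale F (a k) x)}"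

definition Phi_minus_infinity :: "(real \<Rightarrow> real) \<Rightarrow> real \<Rightarrow> real \<Rightarrow> enat" where
  "Phi_minus_infinity F x C =
     Sup {enat n | n. \<exists>a b. interval_chain n a b \<and>
       (\<forall>k\<in>{1..n}. rescale F (a k) x \<ge> C * rescale F (b k) x)}"

definition elastic_at_infinity :: "(real \<Rightarrow> real) \<Rightarrow> bool" where
  "elastic_at_infinity F \<longleftrightarrow>
     (\<exists>C0 C1 r. C0 > 1 \<and> C1 > 1 \<and> r > 0 \<and>
       (\<forall>x. 0 < x \<and> x \<le> 1 \<longrightarrow>
         ereal_of_enat (Phi_plus_infinity F x C0 + Phi_minus_infinity F x C0)
           \<le> ereal (C1 * x powr (- r))))"

end

theory Submission
  imports Defs
begin

text \<open>With \<open>g s = ln (F (exp s)) - s\<close>, elasticity says that each increment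
  \<open>g (s + n) - g s\<close> eventually oscillates by at most a constant independent of \<open>n\<close>. Hyers' argument then gives \<open>g (s + u) - g s = q u + O(1)\<close> for
  large \<open>s\<close>, uniformly in \<open>u\<close> in a window whose length grows slowly with \<open>s\<close>. Interpolating
  \<open>g\<close> linearly between nodes spaced by such windows yields a nondecreasing \<open>m\<close> at bounded
  distance from \<open>g\<close> with \<open>m (s + u) - m s\<close> tending to \<open>q u\<close>. Since \<open>exp (m (ln t))\<close> is
  nondecreasing, its primitive is convex; it is regularly varying by l'Hospital's rule.\<close>

section \<open>From finite interval counts to eventual oscillation bounds\<close>

lemma interval_chain_Suc:
  assumes "interval_chain n a b" "if n = 0 then 1 \<le> s else b n \<le> s" "s < t"
  shows "interval_chain (Suc n) (a(Suc n := s)) (b(Suc n := t))"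
  using assms unfolding interval_chain_def by (auto simp: le_Suc_eq less_Suc_eq split: if_splits)

text \<open>Chains are built greedily: the next pair is taken beyond the last endpoint
  \<open>b n\<close>, so a relation that recurs beyond every threshold admits chains of every
  length.\<close>

lemma interval_chain_of_unbounded:
  assumes step: "\<And>S. S \<ge> 1 \<Longrightarrow> \<exists>s\<ge>S. \<exists>t>s. R s t"
  shows "\<exists>a b. interval_chain n a b \<and> (\<forall>k\<in>{1..n}. R (a k) (b k))"
proof (induction n)
  case 0
  show ?case by (simp add: interval_chain_def)
next
  case (Suc n)
  then obtain a b where ab: "interval_chain n a b" "\<forall>k\<in>{1..n}. R (a k) (b k)" by blast
  define S where "S = (if n = 0 then 1 else max 1 (b n))"
  have "S \<ge> 1" by (simp add: S_def)
  then obtain s t where st: "s \<ge> S" "t > s" "R s t" using step by blast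
  have "interval_chain (Suc n) (a(Suc n := s)) (b(Suc n := t))"
    by (rule interval_chain_Suc[OF ab(1)]) (use st S_def in \<open>auto split: if_splits\<close>)
  moreover have "\<forall>k\<in>{1..Suc n}. R ((a(Suc n := s)) k) ((b(Suc n := t)) k)"
    using ab(2) st(3) by (auto simp: le_Suc_eq)
  ultimately show ?case by blast
qed

text \<open>A finite supremum excludes such recurrence. With \<open>R\<close> arbitrary, one
  argument serves both \<open>Phi_plus_infinity\<close> and
  \<open>Phi_minus_infinity\<close>.\<close>

lemma eventually_no_step:
  assumes "Sup {enat n | n. \<exists>a b. interval_chain n a b \<and> (\<forall>k\<in>{1..n}. R (a k) (b k))} \<noteq> \<infinity>"
  obtains S where "\<And>s t. S \<le> s \<Longrightarrow> s < t \<Longrightarrow> \<not> R s t"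
proof -
  define A where "A = {enat n | n. \<exists>a b. interval_chain n a b \<and> (\<forall>k\<in>{1..n}. R (a k) (b k))}"
  have "\<exists>S\<ge>1. \<forall>s\<ge>S. \<forall>t>s. \<not> R s t"
  proof (rule ccontr)
    assume "\<not> ?thesis"
    then have step: "\<exists>s\<ge>S. \<exists>t>s. R s t" if "S \<ge> 1" for S using that by blast
    have "enat n \<in> A" for n
      unfolding A_def using interval_chain_of_unbounded[of R n, OF step] by blast
    then have le: "enat n \<le> Sup A" for n by (rule Sup_upper)
    obtain N where N: "Sup A = enat N"
      using assms unfolding A_def[symmetric] by (cases "Sup A") simp_all
    show False using le[of "Suc N"] unfolding N by simp
  qed
  then show thesis using that by blast
qed

text \<open>Finiteness of the two counts rules out growth and decay by the factor \<open>C\<close>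
  beyond some threshold. The threshold depends on \<open>x\<close> but \<open>C\<close> does not,
  and this uniformity feeds Hyers' argument. No sign of \<open>F\<close> is known here; the absolute
  value keeps the bound true at \<open>s = t\<close> even for a negative quotient.\<close>

lemma elastic_rescale_oscillation:
  assumes "elastic_at_infinity F"
  obtains C where "C > 1"
    "\<And>x. 0 < x \<Longrightarrow> x \<le> 1 \<Longrightarrow>
       \<exists>S. \<forall>s t. S \<le> s \<longrightarrow> S \<le> t \<longrightarrow> rescale F s x \<le> C * \<bar>rescale F t x\<bar>"
proof -
  obtain C C1 r where C: "C > 1" and fin: "\<And>x. 0 < x \<Longrightarrow> x \<le> 1 \<Longrightarrow>
        ereal_of_enat (Phi_plus_infinity F x C + Phi_minus_infinity F x C) \<le> ereal (C1 * x powr (- r))"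
    using assms unfolding elastic_at_infinity_def by blast
  show thesis
  proof (rule that[OF C])
    fix x :: real assume x: "0 < x" "x \<le> 1"
    have "Phi_plus_infinity F x C \<noteq> \<infinity>"
    proof
      assume "Phi_plus_infinity F x C = \<infinity>"
      then show False using fin[OF x] by simp
    qed
    from eventually_no_step[OF this[unfolded Phi_plus_infinity_def]]
    obtain S1 where S1: "\<And>s t. S1 \<le> s \<Longrightarrow> s < t \<Longrightarrow> \<not> (rescale F t x \<ge> C * rescale F s x)" by metis
    have "Phi_minus_infinity F x C \<noteq> \<infinity>"
    proof
      assume "Phi_minus_infinity F x C = \<infinity>"
      then show False using fin[OF x] by simp
    qed
    from eventually_no_step[OF this[unfolded Phi_minus_infinity_def]]
    obtain S2 where S2: "\<And>s t. S2 \<le> s \<Longrightarrow> s < t \<Longrightarrow> \<not> (rescale F s x \<ge> C * rescale F t x)" by metis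
    have "rescale F s x \<le> C * \<bar>rescale F t x\<bar>"
      if "max S1 S2 \<le> s" "max S1 S2 \<le> t" for s t
    proof -
      have "C * rescale F t x \<le> C * \<bar>rescale F t x\<bar>" "\<bar>rescale F t x\<bar> \<le> C * \<bar>rescale F t x\<bar>"
        using C mult_right_mono[of 1 C "\<bar>rescale F t x\<bar>"] by auto
      then show ?thesis
        using S1[of t s] S2[of s t] that by (cases s t rule: linorder_cases) force+
    qed
    then show "\<exists>S. \<forall>s t. S \<le> s \<longrightarrow> S \<le> t \<longrightarrow> rescale F s x \<le> C * \<bar>rescale F t x\<bar>"
      by blast
  qed
qed

section \<open>Almost linear functions and growing windows\<close>

text \<open>Hyers' argument: the eventual values of the increments form an almost additive sequence.\<close>

lemma almost_constant_increments_imp_almost_linear: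
  fixes g :: "real \<Rightarrow> real"
  assumes osc: "\<And>n::nat. \<exists>S. \<forall>s\<ge>S. \<forall>t\<ge>S.
      \<bar>(g (s + real n) - g s) - (g (t + real n) - g t)\<bar> \<le> c"
  shows "\<exists>q. \<forall>n::nat. \<forall>\<^sub>F s in at_top. \<bar>g (s + real n) - g s - q * real n\<bar> \<le> 4 * c"
proof -
  define D where "D n s = g (s + real n) - g s" for n and s :: real
  have ex: "\<exists>S. \<forall>s\<ge>S. \<forall>t\<ge>S. \<bar>D n s - D n t\<bar> \<le> c" for n
    unfolding D_def by (rule osc)
  obtain S where S: "\<And>n s t. s \<ge> S n \<Longrightarrow> t \<ge> S n \<Longrightarrow> \<bar>D n s - D n t\<bar> \<le> c"
    using ex by metis
  have c0: "0 \<le> c" using S[of 0 "S 0" "S 0"] by simp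
  \<comment> \<open>\<open>d n\<close> represents the eventual values of \<open>D n\<close>, which
    it determines up to \<open>c\<close>.\<close>
  define d where "d n = D n (S n)" for n
  have d: "\<bar>D n s - d n\<bar> \<le> c" if "s \<ge> S n" for n s
    using S[of n s "S n"] that by (simp add: d_def)
  have add: "\<bar>d (m + n) - d m - d n\<bar> \<le> 3 * c" for m n
  proof -
    define s where "s = max (S (m + n)) (max (S m) (S n))"
    \<comment> \<open>The increment over \<open>m + n\<close> splits at \<open>s + real m\<close>;
      replacing each of the three increments by its representative costs \<open>c\<close>.\<close>
    have "D (m + n) s = D m s + D n (s + real m)"
      by (simp add: D_def algebra_simps)
    moreover have "\<bar>D (m + n) s - d (m + n)\<bar> \<le> c" "\<bar>D m s - d m\<bar> \<le> c"
      "\<bar>D n (s + real m) - d n\<bar> \<le> c"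
      by (intro d; simp add: s_def)+
    ultimately show ?thesis by linarith
  qed
  have mult: "\<bar>d (k * n) - real k * d n\<bar> \<le> 3 * c * real k" if "k \<ge> 1" for k n
    using that
  proof (induction k rule: nat_induct_at_least)
    case base
    then show ?case using c0 by simp
  next
    case (Suc k)
    then show ?case using add[of n "k * n"] by (simp add: algebra_simps)
  qed
  \<comment> \<open>\<open>d (m * n)\<close> is compared both with \<open>m\<close> copies of
    \<open>d n\<close> and with \<open>n\<close> copies of \<open>d m\<close>.\<close>
  have cross: "real m * (d n - 3 * c) \<le> real n * (d m + 3 * c)" if "m \<ge> 1" "n \<ge> 1" for m n
    using mult[of m n] mult[of n m] that by (simp add: algebra_simps)
  \<comment> \<open>By \<open>cross\<close> every lower bound for the slope lies below every upper
    bound, so the supremum of the lower bounds satisfies all of them at once; no convergence of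
    \<open>d n / n\<close> has to be shown first.\<close>
  define q where "q = (SUP n\<in>{1..}. (d n - 3 * c) / real n)"
  have le: "(d n - 3 * c) / real n \<le> (d m + 3 * c) / real m" if "m \<ge> 1" "n \<ge> 1" for m n
    using cross[OF that] that by (simp add: field_simps)
  have bdd: "bdd_above ((\<lambda>n. (d n - 3 * c) / real n) ` {1..})"
    by (rule bdd_aboveI2[of _ _ "(d 1 + 3 * c) / real 1"]) (rule le, auto)
  have q: "\<bar>d n - q * real n\<bar> \<le> 3 * c" if "n \<ge> 1" for n
  proof -
    have "(d n - 3 * c) / real n \<le> q"
      unfolding q_def using bdd that by (intro cSUP_upper) auto
    moreover have "q \<le> (d n + 3 * c) / real n"
      unfolding q_def using le that by (intro cSUP_least) auto
    ultimately show ?thesis using that by (simp add: field_simps abs_le_iff)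
  qed
  show ?thesis
  proof (intro exI allI)
    fix n :: nat
    show "\<forall>\<^sub>F s in at_top. \<bar>g (s + real n) - g s - q * real n\<bar> \<le> 4 * c"
    proof (cases "n \<ge> 1")
      case True
      show ?thesis
        using eventually_ge_at_top[of "S n"]
      proof eventually_elim
        case (elim s)
        show ?case using d[OF elim] q[OF True] unfolding D_def by linarith
      qed
    next
      case False
      then have "n = 0" by simp
      then show ?thesis using c0 by simp
    qed
  qed
qed

text \<open>The window contains finitely many integers, so they share a threshold. Between integers,
  monotonicity and \<open>step\<close> cost \<open>P\<close>, and the change of \<open>q * u\<close>
  costs at most \<open>\<bar>q\<bar>\<close>.\<close>

lemma almost_linear_uniform:
  fixes g :: "real \<Rightarrow> real"
  assumes mono: "mono g" and step: "\<And>s. g (s + 1) \<le> g s + P"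
    and lin: "\<And>n::nat. \<forall>\<^sub>F s in at_top. \<bar>g (s + real n) - g s - q * real n\<bar> \<le> K"
  shows "\<forall>\<^sub>F s in at_top. \<forall>u\<in>{0..real n}. \<bar>g (s + u) - g s - q * u\<bar> \<le> K + P + \<bar>q\<bar>"
proof -
  have "\<forall>\<^sub>F s in at_top. \<forall>j\<in>{..n}. \<bar>g (s + real j) - g s - q * real j\<bar> \<le> K"
    using lin by (intro eventually_ball_finite) auto
  then show ?thesis
  proof eventually_elim
    case (elim s)
    show ?case
    proof
      fix u assume u: "u \<in> {0..real n}"
      define j where "j = nat \<lfloor>u\<rfloor>"
      have j: "real j \<le> u" "u \<le> real j + 1" "j \<le> n"
        using u unfolding j_def by (auto simp: nat_le_iff floor_le_iff)
      have "g (s + real j) \<le> g (s + u)" "g (s + u) \<le> g (s + real j + 1)"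
        using j by (auto intro!: monoD[OF mono])
      moreover have "\<bar>q * (u - real j)\<bar> \<le> \<bar>q\<bar> * 1"
        unfolding abs_mult using j by (intro mult_left_mono) auto
      moreover have "\<bar>g (s + real j) - g s - q * real j\<bar> \<le> K" using elim j by auto
      ultimately show "\<bar>g (s + u) - g s - q * u\<bar> \<le> K + P + \<bar>q\<bar>"
        using step[of "s + real j"] by (simp add: algebra_simps)
    qed
  qed
qed

text \<open>This trades a threshold for each fixed \<open>n\<close> for one slowly growing window:
  \<open>L s\<close> is the largest admissible \<open>n\<close> not exceeding \<open>s\<close>. The
  cap makes the set of candidates finite; each fixed \<open>n\<close> eventually belongs to it, so
  \<open>L\<close> tends to infinity.\<close>

lemma diagonal_growth:
  fixes Q :: "nat \<Rightarrow> real \<Rightarrow> bool"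
  assumes "\<And>n. \<forall>\<^sub>F s in at_top. Q n s"
  obtains L :: "real \<Rightarrow> nat" where "filterlim L at_top at_top" "\<forall>\<^sub>F s in at_top. Q (L s) s"
proof -
  define N where "N s = {n. n \<le> nat \<lfloor>s\<rfloor> \<and> Q n s}" for s
  have fin: "finite (N s)" for s by (simp add: N_def)
  define L where "L s = Max (N s)" for s
  have mem: "\<forall>\<^sub>F s in at_top. n \<in> N s" for n
    using assms[of n] eventually_ge_at_top[of "real n"]
    by eventually_elim (auto simp: N_def le_nat_floor)
  show thesis
  proof (rule that)
    show "filterlim L at_top at_top"
      unfolding filterlim_at_top
    proof
      fix n show "\<forall>\<^sub>F s in at_top. n \<le> L s"
        using mem[of n] by eventually_elim (auto simp: L_def fin)
    qed
    show "\<forall>\<^sub>F s in at_top. Q (L s) s"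
      \<comment> \<open>\<open>Max\<close> of an empty set is unspecified; membership of
        \<open>0\<close> makes \<open>N s\<close> nonempty.\<close>
      using mem[of 0]
    proof eventually_elim
      case (elim s)
      then have "L s \<in> N s" unfolding L_def using fin by (intro Max_in) auto
      then show ?case by (simp add: N_def)
    qed
  qed
qed

section \<open>Piecewise linear interpolation between widening nodes\<close>

lemma piecewise_linear_interpolant:
  fixes g :: "real \<Rightarrow> real" and x :: "nat \<Rightarrow> real"
  assumes x: "strict_mono x"
  obtains m where "\<And>s. s \<le> x 0 \<Longrightarrow> m s = g s"
    "\<And>k s. x k \<le> s \<Longrightarrow> s \<le> x (Suc k) \<Longrightarrow>
       m s = g (x k) + (s - x k) * ((g (x (Suc k)) - g (x k)) / (x (Suc k) - x k))"
proof -
  define lin where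
    "lin k s = g (x k) + (s - x k) * ((g (x (Suc k)) - g (x k)) / (x (Suc k) - x k))" for k s
  define m where "m s = (if s \<le> x 0 then g s else lin (LEAST k. s \<le> x (Suc k)) s)" for s
  have less: "x k < x (Suc k)" for k using x by (simp add: strict_mono_less)
  have right: "lin k (x (Suc k)) = g (x (Suc k))" for k
    using less[of k] by (simp add: lin_def)
  have "m s = lin k s" if s: "x k \<le> s" "s \<le> x (Suc k)" for k s
  \<comment> \<open>At a node the \<open>LEAST\<close> picks the piece ending there, so the formula
    of the piece starting there is matched through \<open>right\<close>; at \<open>x 0\<close> the
    value comes from \<open>g\<close>.\<close>
  proof (cases "s = x k")
    case True
    show ?thesis
    proof (cases k)
      case 0
      then show ?thesis using True by (simp add: m_def lin_def)
    next
      case (Suc j)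
      have "x 0 < s" using True Suc x by (simp add: strict_mono_less)
      moreover have "(LEAST i. s \<le> x (Suc i)) = j"
        using True Suc x by (intro Least_equality) (auto simp: strict_mono_less_eq)
      ultimately show ?thesis
        using True Suc right[of j] by (simp add: m_def lin_def)
    qed
  next
    case False
    then have "x k < s" using s by simp
    have "(LEAST i. s \<le> x (Suc i)) = k"
    proof (rule Least_equality)
      fix i assume "s \<le> x (Suc i)"
      then have "x k < x (Suc i)" using \<open>x k < s\<close> by simp
      then show "k \<le> i" using x by (simp add: strict_mono_less)
    qed (rule s)
    moreover have "x 0 < s" using \<open>x k < s\<close> x
      by (meson le_less_trans strict_mono_less_eq zero_le)
    ultimately show ?thesis by (simp add: m_def)
  qed
  then show thesis
    by (intro that[of m]) (auto simp: m_def lin_def)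
qed

text \<open>Increments telescope at the nodes. Applied to \<open>m\<close> and to its negative, this
  yields monotonicity, a Lipschitz bound and two-sided slope bounds; starting at \<open>K\<close>
  admits estimates that hold only for late pieces.\<close>

lemma increment_le_of_pieces:
  fixes m :: "real \<Rightarrow> real" and x :: "nat \<Rightarrow> real"
  assumes x: "strict_mono x" and unb: "\<And>s. \<exists>k. s \<le> x k"
    and pieces: "\<And>k s t. K \<le> k \<Longrightarrow> x k \<le> s \<Longrightarrow> s \<le> t \<Longrightarrow> t \<le> x (Suc k) \<Longrightarrow> m t - m s \<le> B * (t - s)"
    and s: "x K \<le> s" "s \<le> t"
  shows "m t - m s \<le> B * (t - s)"
proof -
  have "m t - m s \<le> B * (t - s)" if "x K \<le> s" "s \<le> t" "t \<le> x (K + n)" for n s t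
    using that
  proof (induction n arbitrary: s t)
    case 0
    then have "s = t" by simp
    then show ?case by simp
  next
    case (Suc n)
    consider "t \<le> x (K + n)" | "x (K + n) \<le> s" | "s \<le> x (K + n)" "x (K + n) \<le> t"
      by linarith
    then show ?case
    proof cases
      case 3
      have "m (x (K + n)) - m s \<le> B * (x (K + n) - s)"
        using Suc 3 by blast
      moreover have "m t - m (x (K + n)) \<le> B * (t - x (K + n))"
        using Suc.prems 3 by (intro pieces[of "K + n"]) auto
      ultimately show ?thesis by (simp add: algebra_simps)
    qed (use Suc pieces[of "K + n"] in auto)
  qed
  moreover obtain k where "t \<le> x k" using unb by blast
  then have "t \<le> x (K + k)" using x by (meson le_add2 order_trans strict_mono_less_eq)
  ultimately show ?thesis using s by blast
qed

text \<open>Each gap is the window length at its left end, so the almost linear estimate based there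
  covers precisely that gap. Gaps of length at least 1 drive the nodes to infinity.\<close>

lemma unbounded_nodes:
  fixes L :: "real \<Rightarrow> nat"
  assumes "\<And>s. s \<ge> S \<Longrightarrow> 1 \<le> L s"
  obtains x :: "nat \<Rightarrow> real" where "x 0 = S" "\<And>k. x (Suc k) = x k + real (L (x k))"
    "strict_mono x" "\<And>s. \<exists>k. s \<le> x k"
proof -
  define x where "x = rec_nat S (\<lambda>_ y. y + real (L y))"
  have x: "x 0 = S" "x (Suc k) = x k + real (L (x k))" for k by (simp_all add: x_def)
  have ge: "S + real k \<le> x k" for k
  proof (induction k)
    case (Suc k)
    then have "1 \<le> L (x k)" by (intro assms) linarith
    then have "1 \<le> real (L (x k))" by simp
    with Suc show ?case unfolding x(2) by simp
  qed (simp add: x)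
  have "strict_mono x"
  proof (rule strict_mono_Suc_iff[THEN iffD2], rule allI)
    fix k
    have "1 \<le> L (x k)" using ge[of k] by (intro assms) linarith
    then show "x k < x (Suc k)" by (simp add: x)
  qed
  moreover have "\<exists>k. s \<le> x k" for s
  proof -
    obtain k where "s - S \<le> real k" using real_arch_simple by blast
    then show ?thesis using ge[of k] by (intro exI[of _ k]) linarith
  qed
  ultimately show thesis using that x by blast
qed

text \<open>If the nodes are spaced ever more widely, an interpolant of a function with
  \<open>g (s + u) - g s = q u + O(1)\<close> has slopes tending to \<open>q\<close> and stays at bounded distance from \<open>g\<close>.\<close>

lemma bounded_perturbation_with_limit_slope:
  fixes g :: "real \<Rightarrow> real"
  assumes mono: "mono g" and cont: "continuous_on UNIV g"
    and L: "filterlim L at_top at_top"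
    and lin: "\<forall>\<^sub>F s in at_top. \<forall>u\<in>{0..real (L s)}. \<bar>g (s + u) - g s - q * u\<bar> \<le> K"
  shows "\<exists>m. mono m \<and> continuous_on UNIV m \<and> (\<forall>s. \<bar>m s - g s\<bar> \<le> 2 * K) \<and>
    (\<forall>u. ((\<lambda>s. m (s + u) - m s) \<longlongrightarrow> q * u) at_top)"
proof -
  have "\<forall>\<^sub>F s in at_top. 1 \<le> L s" using L by (simp add: filterlim_at_top)
  with lin have "\<forall>\<^sub>F s in at_top. 1 \<le> L s \<and> (\<forall>u\<in>{0..real (L s)}. \<bar>g (s + u) - g s - q * u\<bar> \<le> K)"
    by eventually_elim auto
  then obtain S where S: "\<And>s. s \<ge> S \<Longrightarrow> 1 \<le> L s"
    "\<And>s u. s \<ge> S \<Longrightarrow> 0 \<le> u \<Longrightarrow> u \<le> real (L s) \<Longrightarrow> \<bar>g (s + u) - g s - q * u\<bar> \<le> K"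
    unfolding eventually_at_top_linorder by force
  have K0: "0 \<le> K" using S(2)[of S 0] by simp
  obtain x where x: "x 0 = S" "\<And>k. x (Suc k) = x k + real (L (x k))" "strict_mono x"
    "\<And>s. \<exists>k. s \<le> x k"
    using unbounded_nodes[of S L] S(1) by blast
  have xS: "S \<le> x k" for k using x(1,3) by (metis strict_mono_less_eq zero_le)
  define \<sigma> where "\<sigma> k = (g (x (Suc k)) - g (x k)) / real (L (x k))" for k
  obtain m where m0: "\<And>s. s \<le> S \<Longrightarrow> m s = g s"
    and m: "\<And>k s. x k \<le> s \<Longrightarrow> s \<le> x (Suc k) \<Longrightarrow> m s = g (x k) + (s - x k) * \<sigma> k"
    using piecewise_linear_interpolant[OF x(3), of g] unfolding \<sigma>_def x(1,2) by (metis add_diff_cancel_left')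
  have Lpos: "real (L (x k)) \<ge> 1" for k using S(1)[OF xS[of k]] by simp
  \<comment> \<open>The window estimate at \<open>x k\<close>, taken with \<open>u\<close> the full
    gap, fixes the chord slope up to \<open>K\<close> divided by the gap, so widening gaps force the
    slopes to \<open>q\<close>.\<close>
  have \<sigma>: "\<bar>\<sigma> k - q\<bar> \<le> K / real (L (x k))" for k
  proof -
    have "\<bar>g (x (Suc k)) - g (x k) - q * real (L (x k))\<bar> \<le> K"
      using S(2)[OF xS[of k], of "real (L (x k))"] by (simp add: x(2))
    then show ?thesis
      using Lpos[of k] by (simp add: \<sigma>_def field_simps abs_le_iff)
  qed
  have \<sigma>_nonneg: "0 \<le> \<sigma> k" for k
    unfolding \<sigma>_def using monoD[OF mono, of "x k" "x (Suc k)"] by (simp add: x(2))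
  have piece: "m t - m s = \<sigma> k * (t - s)" if "x k \<le> s" "s \<le> t" "t \<le> x (Suc k)" for k s t
    using m[of k s] m[of k t] that by (simp add: algebra_simps)
  have piece_mono: "m s \<le> m t" if "x k \<le> s" "s \<le> t" "t \<le> x (Suc k)" for k s t
    using piece[OF that] mult_nonneg_nonneg[OF \<sigma>_nonneg[of k], of "t - s"] that by simp
  have mono_m: "m s \<le> m t" if "S \<le> s" "s \<le> t" for s t
    \<comment> \<open>Monotonicity of \<open>m\<close> is the bound with \<open>B = 0\<close> for
      its negative.\<close>
    using increment_le_of_pieces[OF x(3,4), of 0 "\<lambda>s. - m s" 0 s t] that
    using piece_mono by (simp add: x(1))
  have \<sigma>_le: "\<sigma> k \<le> \<bar>q\<bar> + K" for k
  proof -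
    have "K / real (L (x k)) \<le> K / 1" using Lpos[of k] K0 by (intro divide_left_mono) auto
    then show ?thesis using \<sigma>[of k] by linarith
  qed
  have lip_m: "m t - m s \<le> (\<bar>q\<bar> + K) * (t - s)" if "S \<le> s" "s \<le> t" for s t
    using increment_le_of_pieces[OF x(3,4), of 0 m "\<bar>q\<bar> + K" s t] that
    by (simp add: piece x(1) mult_right_mono[OF \<sigma>_le])
  show ?thesis
  proof (intro exI conjI allI)
    show "mono m"
    proof (rule monoI)
      fix s t :: real assume "s \<le> t"
      consider "t \<le> S" | "S \<le> s" | "s \<le> S" "S \<le> t" by linarith
      then show "m s \<le> m t"
      proof cases
        case 1
        then show ?thesis using \<open>s \<le> t\<close> m0 monoD[OF mono] by simp
      next
        case 2
        then show ?thesis using \<open>s \<le> t\<close> by (rule mono_m)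
      next
        case 3
        then have "m s \<le> m S" using m0 monoD[OF mono] by simp
        also have "m S \<le> m t" using 3 by (intro mono_m) auto
        finally show ?thesis .
      qed
    qed
    \<comment> \<open>Left of \<open>S\<close> the interpolant is \<open>g\<close> itself and
      inherits continuity from \<open>cont\<close>; the Lipschitz bound covers the right half, and
      the two are glued at \<open>S\<close>.\<close>
    have "(\<bar>q\<bar> + K)-lipschitz_on {S..} m"
    proof (rule lipschitz_onI)
      fix s t assume "s \<in> {S..}" "t \<in> {S..}"
      then show "dist (m s) (m t) \<le> (\<bar>q\<bar> + K) * dist s t"
        using lip_m[of s t] lip_m[of t s] mono_m[of s t] mono_m[of t s]
        by (cases "s \<le> t") (auto simp: dist_real_def)
    qed (use K0 in simp)
    then have "continuous_on {S..} m" by (rule lipschitz_on_continuous_on)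
    moreover have "continuous_on {..S} m"
      by (rule continuous_on_eq[OF continuous_on_subset[OF cont]]) (auto simp: m0)
    ultimately have "continuous_on ({..S} \<union> {S..}) m"
      by (intro continuous_on_closed_Un) auto
    moreover have "{..S} \<union> {S..} = UNIV" by auto
    ultimately show "continuous_on UNIV m" by simp
    \<comment> \<open>Inside a piece both \<open>g\<close> and its chord stay within
      \<open>K\<close> of the line of slope \<open>q\<close> through the left node.\<close>
    show "\<bar>m s - g s\<bar> \<le> 2 * K" for s
    proof (cases "s \<le> S")
      case True
      then show ?thesis using m0 K0 by simp
    next
      case False
      define k where "k = (LEAST k. s \<le> x (Suc k))"
      have "\<exists>k. s \<le> x (Suc k)"
        using x(3,4) by (meson lessI less_imp_le order_trans strict_monoD)
      then have k1: "s \<le> x (Suc k)" unfolding k_def by (rule LeastI_ex)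
      have k2: "x k \<le> s"
      proof (cases k)
        case 0
        then show ?thesis using False x(1) by simp
      next
        case (Suc j)
        then have "\<not> s \<le> x (Suc j)" using not_less_Least[of j "\<lambda>k. s \<le> x (Suc k)"] k_def by simp
        then show ?thesis using Suc by simp
      qed
      define \<delta> where "\<delta> = s - x k"
      have \<delta>: "0 \<le> \<delta>" "\<delta> \<le> real (L (x k))" using k1 k2 by (auto simp: \<delta>_def x(2))
      have "\<bar>g s - g (x k) - q * \<delta>\<bar> \<le> K"
        using S(2)[OF xS[of k] \<delta>] by (simp add: \<delta>_def)
      moreover have "\<bar>\<delta> * (\<sigma> k - q)\<bar> \<le> K"
      proof -
        have "\<bar>\<delta> * (\<sigma> k - q)\<bar> \<le> real (L (x k)) * (K / real (L (x k)))"
          unfolding abs_mult using \<delta> \<sigma>[of k] by (intro mult_mono) auto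
        then show ?thesis using Lpos[of k] by simp
      qed
      moreover have "m s - g s = \<delta> * (\<sigma> k - q) - (g s - g (x k) - q * \<delta>)"
        using m[OF k2 k1] by (simp add: \<delta>_def algebra_simps)
      ultimately show ?thesis by linarith
    qed
    fix u
    show "((\<lambda>s. m (s + u) - m s) \<longlongrightarrow> q * u) at_top"
    proof (rule tendstoI)
      fix e :: real assume "0 < e"
      \<comment> \<open>Chosen so that \<open>\<epsilon> * \<bar>u\<bar> < e\<close>; the summand
        \<open>1\<close> keeps the denominator positive when \<open>u = 0\<close>.\<close>
      define \<epsilon> where "\<epsilon> = e / (2 * (\<bar>u\<bar> + 1))"
      have \<epsilon>: "\<epsilon> > 0" using \<open>0 < e\<close> by (simp add: \<epsilon>_def)
      obtain n :: nat where n: "K / \<epsilon> < real n" using reals_Archimedean2 by blast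
      have "n > 0" using n K0 \<epsilon> by (cases n) (auto simp: divide_less_0_iff)
      have "\<forall>\<^sub>F s in at_top. n \<le> L s" using L by (simp add: filterlim_at_top)
      then obtain S' where S': "\<And>s. s \<ge> S' \<Longrightarrow> n \<le> L s"
        unfolding eventually_at_top_linorder by blast
      obtain k0 where k0: "S' \<le> x k0" using x(4) by blast
      have slope: "\<bar>\<sigma> k - q\<bar> \<le> \<epsilon>" if "k0 \<le> k" for k
      proof -
        have "x k0 \<le> x k" using that x(3) by (simp add: strict_mono_less_eq)
        then have "n \<le> L (x k)" using k0 by (intro S') simp
        then have "K / real (L (x k)) \<le> K / real n"
          using \<open>n > 0\<close> K0 by (intro divide_left_mono) auto
        also have "K / real n \<le> \<epsilon>" using n \<epsilon> \<open>n > 0\<close> by (simp add: field_simps)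
        finally show ?thesis using \<sigma>[of k] by linarith
      qed
      have up: "m t - m s \<le> (q + \<epsilon>) * (t - s)" if "x k0 \<le> s" "s \<le> t" for s t
      proof (rule increment_le_of_pieces[OF x(3,4) _ that])
        fix k s t assume k: "k0 \<le> k" "x k \<le> s" "s \<le> t" "t \<le> x (Suc k)"
        show "m t - m s \<le> (q + \<epsilon>) * (t - s)"
          unfolding piece[OF k(2-4)] using slope[OF k(1)] k(3) by (intro mult_right_mono) auto
      qed
      have low: "- m t - - m s \<le> - (q - \<epsilon>) * (t - s)" if "x k0 \<le> s" "s \<le> t" for s t
      proof (rule increment_le_of_pieces[OF x(3,4) _ that, where m = "\<lambda>s. - m s"])
        fix k s t assume k: "k0 \<le> k" "x k \<le> s" "s \<le> t" "t \<le> x (Suc k)"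
        have "(q - \<epsilon>) * (t - s) \<le> \<sigma> k * (t - s)"
          using slope[OF k(1)] k(3) by (intro mult_right_mono) auto
        then show "- m t - - m s \<le> - (q - \<epsilon>) * (t - s)"
          using piece[OF k(2-4)] by (simp add: algebra_simps)
      qed
      have est: "\<bar>m t - m s - q * (t - s)\<bar> \<le> \<epsilon> * (t - s)" if "x k0 \<le> s" "s \<le> t" for s t
        using up[OF that] low[OF that] by (simp add: abs_le_iff algebra_simps)
      have small: "\<epsilon> * \<bar>u\<bar> < e"
      proof -
        have "e * \<bar>u\<bar> < e * (2 * (\<bar>u\<bar> + 1))" using \<open>0 < e\<close> by (intro mult_strict_left_mono) auto
        then show ?thesis by (simp add: \<epsilon>_def field_simps)
      qed
      show "\<forall>\<^sub>F s in at_top. dist (m (s + u) - m s) (q * u) < e"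
        \<comment> \<open>The margin \<open>\<bar>u\<bar>\<close> keeps \<open>s + u\<close> beyond
          \<open>x k0\<close> also for negative \<open>u\<close>.\<close>
        using eventually_ge_at_top[of "x k0 + \<bar>u\<bar>"]
      proof eventually_elim
        case (elim s)
        show ?case
        proof (cases "u \<ge> 0")
          case True
          then show ?thesis using est[of s "s + u"] elim small by (simp add: dist_real_def)
        next
          case False
          then show ?thesis using est[of "s + u" s] elim small
            by (simp add: dist_real_def)
        qed
      qed
    qed
  qed
qed

section \<open>Primitives of nondecreasing functions\<close>

text \<open>These bounds stand in for the mean value theorem where \<open>f\<close> may jump. The
  intended \<open>f\<close> is \<open>0\<close> at \<open>0\<close> but may have a positive limit
  there.\<close>

lemma integral_mono_on_bounds:
  fixes f :: "real \<Rightarrow> real"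
  assumes f: "mono_on {0..} f" and st: "0 \<le> s" "s \<le> t"
  shows "f s * (t - s) \<le> integral {0..t} f - integral {0..s} f"
    and "integral {0..t} f - integral {0..s} f \<le> f t * (t - s)"
proof -
  have int: "f integrable_on {a..b}" if "0 \<le> a" for a b
    using f that by (intro integrable_on_mono_on) (auto elim: mono_on_subset)
  have eq: "integral {0..t} f - integral {0..s} f = integral {s..t} f"
    using Henstock_Kurzweil_Integration.integral_combine[of 0 s t f] int st by simp
  have "integral {s..t} (\<lambda>_. f s) \<le> integral {s..t} f"
    using st int by (intro integral_le) (auto intro!: mono_onD[OF f])
  then show "f s * (t - s) \<le> integral {0..t} f - integral {0..s} f"
    using st by (simp add: eq mult.commute)
  have "integral {s..t} f \<le> integral {s..t} (\<lambda>_. f t)"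
    using st int by (intro integral_le) (auto intro!: mono_onD[OF f])
  then show "integral {0..t} f - integral {0..s} f \<le> f t * (t - s)"
    using st by (simp add: eq mult.commute)
qed

text \<open>Mean slopes of the primitive are at most \<open>f z\<close> to the left of
  \<open>z\<close> and at least \<open>f z\<close> to the right.\<close>

lemma convex_on_integral_mono_on:
  fixes f :: "real \<Rightarrow> real"
  assumes f: "mono_on {0..} f"
  shows "convex_on {0..} (\<lambda>t. integral {0..t} f)"
proof (rule convex_on_linorderI)
  define G where "G t = integral {0..t} f" for t
  fix r x y :: real
  assume *: "0 < r" "r < 1" "x \<in> {0..}" "y \<in> {0..}" "x < y"
  define z where "z = (1 - r) *\<^sub>R x + r *\<^sub>R y"
  have zx: "z - x = r * (y - x)" and yz: "y - z = (1 - r) * (y - x)"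
    by (simp_all add: z_def algebra_simps)
  then have le: "x \<le> z" "z \<le> y"
    using * by (metis diff_ge_0_iff_ge less_imp_le mult_nonneg_nonneg)+
  have "(1 - r) * (G z - G x) \<le> (1 - r) * (f z * (z - x))"
    using integral_mono_on_bounds(2)[OF f, of x z] le * by (intro mult_left_mono) (auto simp: G_def)
  \<comment> \<open>Both sides equal \<open>f z\<close> times
    \<open>r * (1 - r) * (y - x)\<close>.\<close>
  also have "\<dots> = r * (f z * (y - z))" by (simp add: zx yz)
  also have "\<dots> \<le> r * (G y - G z)"
    using integral_mono_on_bounds(1)[OF f, of z y] le * by (intro mult_left_mono) (auto simp: G_def)
  finally show "integral {0..(1 - r) *\<^sub>R x + r *\<^sub>R y} f
      \<le> (1 - r) * integral {0..x} f + r * integral {0..y} f"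
    unfolding z_def[symmetric] G_def[symmetric] by (simp add: algebra_simps)
qed simp

lemma orlicz_function_integral:
  fixes f :: "real \<Rightarrow> real"
  assumes f: "mono_on {0..} f" and f0: "0 \<le> f 0" and pos: "\<And>t. 0 < t \<Longrightarrow> 0 < f t"
  shows "orlicz_function (\<lambda>t. integral {0..t} f)"
proof -
  define G where "G t = integral {0..t} f" for t
  have G0: "G 0 = 0" by (simp add: G_def)
  have mono: "G s < G t" if "0 \<le> s" "s < t" for s t
  proof -
    \<comment> \<open>\<open>f s\<close> may vanish at \<open>s = 0\<close>, so strict growth is
      drawn from the second half of the interval, where \<open>f z > 0\<close> is a lower
      bound.\<close>
    define z where "z = (s + t) / 2"
    have z: "s < z" "z < t" "0 < z" using that by (auto simp: z_def)
    have "0 \<le> f s" using f0 pos[of s] that by (cases "s = 0") auto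
    then have "0 \<le> f s * (z - s)" using z by simp
    also have "\<dots> \<le> G z - G s"
      using integral_mono_on_bounds(1)[OF f, of s z] z that by (simp add: G_def)
    finally have "G s \<le> G z" by simp
    moreover have "0 < f z * (t - z)" using pos z by simp
    moreover have "f z * (t - z) \<le> G t - G z"
      using integral_mono_on_bounds(1)[OF f, of z t] z by (simp add: G_def)
    ultimately show ?thesis by linarith
  qed
  have "continuous_on {0..} G"
  proof -
    have cont: "continuous_on {0..b} G" for b
      unfolding G_def using f
      by (intro indefinite_integral_continuous_1 integrable_on_mono_on) (auto elim: mono_on_subset)
    show "continuous_on {0..} G"
      unfolding continuous_on_eq_continuous_within
    proof
      fix x :: real assume x: "x \<in> {0..}"
      have "continuous (at x within {0..x+1}) G"
        using cont[of "x + 1"] x by (simp add: continuous_on_eq_continuous_within)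
      moreover have "at x within {0..} = at x within {0..x+1}"
        by (rule at_within_nhd[of _ "{..<x+1}"]) auto
      ultimately show "continuous (at x within {0..}) G" by simp
    qed
  qed
  moreover have "strict_mono_on {0..} G" using mono by (intro strict_mono_onI) auto
  moreover have "G ` {0..} \<subseteq> {0..}"
    using mono[of 0] G0 by (force simp: le_less)
  moreover have "convex_on {0..} G" unfolding G_def by (rule convex_on_integral_mono_on[OF f])
  ultimately show ?thesis using G0 unfolding orlicz_function_def G_def by simp
qed

text \<open>\<open>G (t * x)\<close> has derivative \<open>x * f (t * x)\<close> in
  \<open>t\<close>, so by l'Hospital's rule its quotient by \<open>G t\<close> tends to
  \<open>x\<close> times the limit for \<open>f\<close>.\<close>

lemma regularly_varying_integral:
  fixes f :: "real \<Rightarrow> real"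
  assumes f: "mono_on {0..} f" and pos: "\<And>t. 0 < t \<Longrightarrow> 0 < f t"
    and cont: "continuous_on {0<..} f"
    and lim: "\<And>x. 0 < x \<Longrightarrow> \<exists>l. ((\<lambda>t. f (t * x) / f t) \<longlongrightarrow> l) at_top"
  shows "regularly_varying_at_infinity (\<lambda>t. integral {0..t} f)"
  unfolding regularly_varying_at_infinity_def
proof (intro allI impI)
  define G where "G t = integral {0..t} f" for t
  have deriv: "(G has_real_derivative f t) (at t)" if "0 < t" for t
  proof -
    have "f integrable_on {0..t+1}"
      using f by (intro integrable_on_mono_on) (auto elim: mono_on_subset)
    moreover have "isCont f t" using cont that by (simp add: continuous_on_eq_continuous_at)
    ultimately have "(G has_vector_derivative f t) (at t within {0..t+1})"
      using that integral_has_vector_derivative_continuous_at[of f 0 "t + 1" t "{}"]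
      by (simp add: G_def[abs_def] continuous_at_imp_continuous_at_within)
    moreover have "at t within {0..t+1} = at t"
      using that by (intro at_within_interior) auto
    ultimately show ?thesis by (simp add: has_real_derivative_iff_has_vector_derivative)
  qed
  \<comment> \<open>Since \<open>f\<close> is nondecreasing and \<open>f 1 > 0\<close>, the
    primitive dominates an increasing affine function from \<open>1\<close> on.\<close>
  have top: "filterlim G at_top at_top"
  proof (rule filterlim_at_top_mono)
    show "filterlim (\<lambda>t. G 1 + f 1 * (t - 1)) at_top at_top"
      by (intro filterlim_tendsto_add_at_top[OF tendsto_const]
          filterlim_tendsto_pos_mult_at_top[OF tendsto_const] pos)
        (auto intro!: filterlim_tendsto_add_at_top[OF tendsto_const filterlim_ident, of "-1::real", simplified])
    show "\<forall>\<^sub>F t in at_top. G 1 + f 1 * (t - 1) \<le> G t"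
      using eventually_ge_at_top[of 1]
    proof eventually_elim
      case (elim t)
      then show ?case using integral_mono_on_bounds(1)[OF f, of 1 t] by (simp add: G_def)
    qed
  qed
  fix x :: real assume "0 \<le> x"
  show "\<exists>l. ((\<lambda>t. integral {0..t * x} f / integral {0..t} f) \<longlongrightarrow> l) at_top"
  proof (cases "x = 0")
    case True
    then show ?thesis by (auto intro!: exI[of _ 0])
  next
    case False
    then have "0 < x" using \<open>0 \<le> x\<close> by simp
    then obtain l where l: "((\<lambda>t. f (t * x) / f t) \<longlongrightarrow> l) at_top" using lim by blast
    have "((\<lambda>t. G (t * x) / G t) \<longlongrightarrow> x * l) at_top"
    proof (rule lhospital_at_top_at_top[OF top, where f' = "\<lambda>t. x * f (t * x)" and g' = f])
      show "\<forall>\<^sub>F t in at_top. f t \<noteq> 0"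
        using eventually_gt_at_top[of 0] by eventually_elim (use pos in force)
      show "\<forall>\<^sub>F t in at_top. (G has_real_derivative f t) (at t)"
        using eventually_gt_at_top[of 0] by eventually_elim (rule deriv)
      show "\<forall>\<^sub>F t in at_top. ((\<lambda>t. G (t * x)) has_real_derivative x * f (t * x)) (at t)"
        using eventually_gt_at_top[of 0]
      proof eventually_elim
        case (elim t)
        have "(G has_real_derivative f (t * x)) (at (t * x))"
          using elim \<open>0 < x\<close> by (intro deriv) simp
        moreover have "((\<lambda>t. t * x) has_real_derivative x) (at t)"
          by (auto intro!: derivative_eq_intros)
        ultimately show ?case
          using DERIV_chain2[of G "f (t * x)" "\<lambda>t. t * x" t x] by (simp add: mult.commute)
      qed
      show "((\<lambda>t. x * f (t * x) / f t) \<longlongrightarrow> x * l) at_top"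
        using tendsto_mult_left[OF l, of x] by simp
    qed
    then show ?thesis unfolding G_def by blast
  qed
qed

section \<open>Scaling inequalities and equivalence with a primitive\<close>

lemma orlicz_scale_le:
  assumes "orlicz_function F" "0 \<le> t" "0 \<le> c" "c \<le> 1"
  shows "F (c * t) \<le> c * F t"
  using assms convex_onD[of "{0..}" F c 0 t] by (simp add: orlicz_function_def)

lemma orlicz_scale_ge:
  assumes F: "orlicz_function F" and "0 \<le> t" "1 \<le> c"
  shows "c * F t \<le> F (c * t)"
  using orlicz_scale_le[OF F, of "c * t" "1 / c"] assms by (simp add: field_simps)

lemma orlicz_mono:
  assumes "orlicz_function F" "0 \<le> s" "s \<le> t"
  shows "F s \<le> F t"
  using assms strict_mono_on_leD[of "{0..}" F s t] by (simp add: orlicz_function_def)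

lemma orlicz_pos:
  assumes "orlicz_function F" "0 < t"
  shows "0 < F t"
  using assms strict_mono_onD[of "{0..}" F 0 t] by (simp add: orlicz_function_def)

text \<open>Monotonicity places the primitive between \<open>f (t / 2) * (t / 2)\<close> and
  \<open>t * f t\<close>, which \<open>bounds\<close> compares with values of \<open>F\<close>;
  convexity then moves constant factors into the argument. In the witness \<open>2 * C\<close> the
  \<open>2\<close> comes from halving \<open>t\<close> and the \<open>C\<close> from
  \<open>bounds\<close>.\<close>

lemma orlicz_equivalent_integral:
  assumes F: "orlicz_function F" and f: "mono_on {0..} f" and f0: "0 \<le> f 0" and C: "1 \<le> C"
    and bounds: "\<And>t. 0 < t \<Longrightarrow> F t / C \<le> t * f t" "\<And>t. 0 < t \<Longrightarrow> t * f t \<le> C * F t"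
  shows "orlicz_equivalent F (\<lambda>t. integral {0..t} f)"
  unfolding orlicz_equivalent_def
proof (intro exI[of _ "2 * C"] conjI allI impI)
  fix t :: real assume "0 \<le> t"
  have F0: "F 0 = 0" using F by (simp add: orlicz_function_def)
  show "F (t / (2 * C)) \<le> integral {0..t} f"
  proof (cases "t = 0")
    case False
    then have t: "0 < t" using \<open>0 \<le> t\<close> by simp
    have "F (t / (2 * C)) = F (1 / C * (t / 2))" by (simp add: field_simps)
    also have "\<dots> \<le> 1 / C * F (t / 2)"
      using t C by (intro orlicz_scale_le[OF F]) auto
    also have "\<dots> \<le> f (t / 2) * (t - t / 2)"
      using bounds(1)[of "t / 2"] t by (simp add: mult.commute)
    also have "\<dots> \<le> integral {0..t} f - integral {0..t / 2} f"
      using t by (intro integral_mono_on_bounds(1)[OF f]) auto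
    also have "0 \<le> f 0 * (t / 2 - 0)" using f0 t by simp
    then have "integral {0..t} f - integral {0..t / 2} f \<le> integral {0..t} f"
      using integral_mono_on_bounds(1)[OF f, of 0 "t / 2"] t by simp
    finally show ?thesis .
  qed (simp add: F0)
  show "integral {0..t} f \<le> F (2 * C * t)"
  proof (cases "t = 0")
    case False
    then have t: "0 < t" using \<open>0 \<le> t\<close> by simp
    have "integral {0..t} f \<le> t * f t"
      using integral_mono_on_bounds(2)[OF f, of 0 t] t by (simp add: mult.commute)
    also have "\<dots> \<le> C * F t" by (rule bounds(2)[OF t])
    also have "\<dots> \<le> (2 * C) * F t" using C orlicz_pos[OF F t] by simp
    also have "\<dots> \<le> F (2 * C * t)" using t C by (intro orlicz_scale_ge[OF F]) auto
    finally show ?thesis .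
  qed (simp add: F0)
qed (use C in simp)

section \<open>Orlicz functions in logarithmic coordinates\<close>

text \<open>This is the logarithm of \<open>F t / t\<close> at \<open>t = exp s\<close>. By
  convexity this quotient is still nondecreasing, and it has the size expected of the derivative of
  an equivalent function.\<close>

definition log_profile :: "(real \<Rightarrow> real) \<Rightarrow> real \<Rightarrow> real" where
  "log_profile F s = ln (F (exp s)) - s"

lemma orlicz_log_profile:
  fixes F :: "real \<Rightarrow> real"
  assumes F: "orlicz_function F" and D2: "Delta2_condition F"
  defines "g \<equiv> log_profile F"
  shows "mono g" "continuous_on UNIV g" "\<exists>P. \<forall>s. g (s + 1) \<le> g s + P"
proof -
  have g_eq: "g = (\<lambda>s. ln (F (exp s)) - s)" by (simp add: g_def log_profile_def fun_eq_iff)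
  have pos: "0 < F (exp s)" for s by (simp add: orlicz_pos[OF F])
  show "mono g"
  proof (rule monoI)
    fix s t :: real assume "s \<le> t"
    then have "exp (t - s) * F (exp s) \<le> F (exp (t - s) * exp s)"
      by (intro orlicz_scale_ge[OF F]) auto
    also have "exp (t - s) * exp s = exp t" by (simp flip: exp_add)
    finally have "ln (exp (t - s) * F (exp s)) \<le> ln (F (exp t))"
      using pos by (subst ln_le_cancel_iff) auto
    then show "g s \<le> g t" using pos[of s] by (simp add: g_eq ln_mult)
  qed
  have "continuous_on UNIV (\<lambda>s. F (exp s))"
    by (rule continuous_on_compose2[of "{0..}" F])
      (use F in \<open>auto simp: orlicz_function_def intro!: continuous_intros\<close>)
  then show "continuous_on UNIV g"
    unfolding g_eq using pos by (intro continuous_intros) (auto simp: less_imp_neq[symmetric])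
  obtain \<Delta> where \<Delta>: "\<And>x. 0 \<le> x \<Longrightarrow> F (2 * x) \<le> \<Delta> * F x"
    using D2 unfolding Delta2_condition_def by blast
  have "0 < \<Delta> * F 1" using \<Delta>[of 1] orlicz_pos[OF F, of 2] by simp
  then have \<Delta>pos: "0 < \<Delta>" using orlicz_pos[OF F, of 1] by (simp add: zero_less_mult_iff)
  \<comment> \<open>A unit step multiplies the argument by \<open>exp 1\<close>, which is at most 3
    by \<open>exp_le\<close>, so two doublings cover it.\<close>
  have "g (s + 1) \<le> g s + ln (\<Delta> * \<Delta>)" for s
  proof -
    have "F (exp (s + 1)) \<le> F (2 * (2 * exp s))"
      using exp_le by (intro orlicz_mono[OF F]) (auto simp: exp_add)
    also have "\<dots> \<le> \<Delta> * F (2 * exp s)" by (rule \<Delta>) simp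
    also have "\<dots> \<le> \<Delta> * (\<Delta> * F (exp s))" using \<Delta>pos by (intro mult_left_mono \<Delta>) auto
    finally have "ln (F (exp (s + 1))) \<le> ln (\<Delta> * \<Delta> * F (exp s))"
      using pos \<Delta>pos by (subst ln_le_cancel_iff) (auto simp: mult.assoc)
    then show ?thesis using pos[of s] \<Delta>pos by (simp add: g_eq ln_mult)
  qed
  then show "\<exists>P. \<forall>s. g (s + 1) \<le> g s + P" by blast
qed

text \<open>At \<open>x = exp (- real n)\<close> and base \<open>exp (s + real n)\<close>, the
  rescaled value is \<open>exp\<close> of minus the increment of \<open>g\<close>, times
  \<open>exp (- real n)\<close>. That factor cancels in comparisons, so \<open>ln C\<close> bounds
  the oscillation for every \<open>n\<close>.\<close>

lemma elastic_log_oscillation: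
  fixes F :: "real \<Rightarrow> real"
  assumes F: "orlicz_function F" and el: "elastic_at_infinity F"
  defines "g \<equiv> log_profile F"
  shows "\<exists>c. \<forall>n::nat. \<exists>S. \<forall>s\<ge>S. \<forall>t\<ge>S.
      \<bar>(g (s + real n) - g s) - (g (t + real n) - g t)\<bar> \<le> c"
proof -
  have g_eq: "g = (\<lambda>s. ln (F (exp s)) - s)" by (simp add: g_def log_profile_def fun_eq_iff)
  have pos: "0 < F (exp s)" for s by (simp add: orlicz_pos[OF F])
  obtain C where C: "C > 1" and osc: "\<And>x. 0 < x \<Longrightarrow> x \<le> 1 \<Longrightarrow>
       \<exists>S. \<forall>s t. S \<le> s \<longrightarrow> S \<le> t \<longrightarrow> rescale F s x \<le> C * \<bar>rescale F t x\<bar>"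
    using elastic_rescale_oscillation[OF el] by metis
  have "\<exists>S. \<forall>s\<ge>S. \<forall>t\<ge>S. \<bar>(g (s + real n) - g s) - (g (t + real n) - g t)\<bar> \<le> ln C" for n
  proof -
    obtain S where S: "\<And>s t. S \<le> s \<Longrightarrow> S \<le> t \<Longrightarrow>
        rescale F s (exp (- real n)) \<le> C * \<bar>rescale F t (exp (- real n))\<bar>"
      using osc[of "exp (- real n)"] by auto
    have resc: "rescale F (exp (s + real n)) (exp (- real n)) = exp (- (g (s + real n) - g s) - real n)" for s
    proof -
      have "exp (- (g (s + real n) - g s) - real n) = exp (ln (F (exp s)) - ln (F (exp (s + real n))))"
        by (simp add: g_eq)
      also have "\<dots> = F (exp s) / F (exp (s + real n))"
        using pos by (simp add: exp_diff)
      also have "\<dots> = rescale F (exp (s + real n)) (exp (- real n))"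
        by (simp add: rescale_def flip: exp_add)
      finally show ?thesis by simp
    qed
    \<comment> \<open>The threshold is carried to the logarithmic scale; \<open>max 1\<close> keeps
      the argument of \<open>ln\<close> positive.\<close>
    have le: "(g (t + real n) - g t) - (g (s + real n) - g s) \<le> ln C"
      if "ln (max 1 S) \<le> s" "ln (max 1 S) \<le> t" for s t
    proof -
      have large: "S \<le> exp (r + real n)" if "ln (max 1 S) \<le> r" for r
      proof -
        have "max 1 S = exp (ln (max 1 S))" by simp
        also have "\<dots> \<le> exp (r + real n)" using that by (subst exp_le_cancel_iff) simp
        finally show ?thesis by simp
      qed
      have "exp (- (g (s + real n) - g s) - real n) \<le> C * exp (- (g (t + real n) - g t) - real n)"
        using S[OF large large, OF that] by (simp add: resc)
      also have "\<dots> = exp (ln C + (- (g (t + real n) - g t) - real n))"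
        using C by (simp only: exp_add) simp
      finally show ?thesis by simp
    qed
    then show ?thesis by (intro exI[of _ "ln (max 1 S)"]) (simp add: abs_le_iff)
  qed
  then show ?thesis by blast
qed

section \<open>Construction of the equivalent regularly varying function\<close>

theorem lemma6p5:
  fixes F :: "real \<Rightarrow> real"
  assumes "orlicz_function F"
    and "Delta2_condition F"
    and "elastic_at_infinity F"
  shows "\<exists>G :: real \<Rightarrow> real. orlicz_function G \<and> regularly_varying_at_infinity G \<and>
           orlicz_equivalent F G"
proof -
  note F = assms(1)
  define g where "g = log_profile F"
  have g_eq: "g = (\<lambda>s. ln (F (exp s)) - s)" by (simp add: g_def log_profile_def fun_eq_iff)
  note profile = orlicz_log_profile[OF assms(1,2), folded g_def]
  obtain P where P: "\<And>s. g (s + 1) \<le> g s + P" using profile(3) by blast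
  obtain c where c: "\<And>n::nat. \<exists>S. \<forall>s\<ge>S. \<forall>t\<ge>S.
      \<bar>(g (s + real n) - g s) - (g (t + real n) - g t)\<bar> \<le> c"
    using elastic_log_oscillation[OF assms(1,3), folded g_def] by blast
  obtain q where q: "\<And>n::nat. \<forall>\<^sub>F s in at_top. \<bar>g (s + real n) - g s - q * real n\<bar> \<le> 4 * c"
    using almost_constant_increments_imp_almost_linear[OF c] by blast
  define K where "K = 4 * c + P + \<bar>q\<bar>"
  have "\<forall>\<^sub>F s in at_top. \<forall>u\<in>{0..real n}. \<bar>g (s + u) - g s - q * u\<bar> \<le> K" for n
    unfolding K_def by (rule almost_linear_uniform[OF profile(1) P q])
  then obtain L where L: "filterlim L at_top at_top"
    "\<forall>\<^sub>F s in at_top. \<forall>u\<in>{0..real (L s)}. \<bar>g (s + u) - g s - q * u\<bar> \<le> K"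
    by (rule diagonal_growth)
  obtain m where m: "mono m" "continuous_on UNIV m" and near: "\<And>s. \<bar>m s - g s\<bar> \<le> 2 * K"
    and lim: "\<And>u. ((\<lambda>s. m (s + u) - m s) \<longlongrightarrow> q * u) at_top"
    using bounded_perturbation_with_limit_slope[OF profile(1,2) L] by blast
  have K0: "0 \<le> K" using near[of 0] by linarith
  \<comment> \<open>The value \<open>0\<close> for nonpositive arguments keeps \<open>f\<close>
    nondecreasing on \<open>{0..}\<close> whatever \<open>ln\<close> is at \<open>0\<close>.\<close>
  define f where "f t = (if t \<le> 0 then 0 else exp (m (ln t)))" for t :: real
  have f_pos: "0 < f t" if "0 < t" for t using that by (simp add: f_def)
  have f_mono: "mono_on {0..} f"
    by (rule mono_onI) (auto simp: f_def intro!: monoD[OF m(1)])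
  have f_cont: "continuous_on {0<..} f"
  proof (rule continuous_on_eq)
    show "continuous_on {0<..} (\<lambda>t. exp (m (ln t)))"
      by (intro continuous_on_exp continuous_on_compose2[OF m(2)]) (auto intro!: continuous_intros)
  qed (simp add: f_def)
  have f_lim: "\<exists>l. ((\<lambda>t. f (t * x) / f t) \<longlongrightarrow> l) at_top" if x: "0 < x" for x
  proof -
    \<comment> \<open>The limit is \<open>x\<close> to the power \<open>q\<close>; integration
      raises the index to \<open>q + 1\<close>.\<close>
    have "((\<lambda>t. exp (m (ln t + ln x) - m (ln t))) \<longlongrightarrow> exp (q * ln x)) at_top"
      by (intro tendsto_exp filterlim_compose[OF lim ln_at_top])
    moreover have "\<forall>\<^sub>F t in at_top. exp (m (ln t + ln x) - m (ln t)) = f (t * x) / f t"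
      using eventually_gt_at_top[of 0]
    proof eventually_elim
      case (elim t)
      then have "0 < t * x" using x by simp
      then show ?case using elim x by (simp add: f_def exp_diff ln_mult not_le)
    qed
    ultimately have "((\<lambda>t. f (t * x) / f t) \<longlongrightarrow> exp (q * ln x)) at_top"
      by (rule Lim_transform_eventually)
    then show ?thesis by blast
  qed
  \<comment> \<open>In this form the distance \<open>2 * K\<close> between \<open>m\<close> and
    \<open>g\<close> becomes a factor \<open>exp (2 * K)\<close> between \<open>t * f t\<close> and
    \<open>F t\<close>.\<close>
  have F_eq: "F t = exp (ln t + g (ln t))" and tf_eq: "t * f t = exp (ln t + m (ln t))" if "0 < t" for t
    using that orlicz_pos[OF F that] by (simp_all add: g_eq f_def exp_add)
  show ?thesis
  proof (intro exI conjI)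
    show "orlicz_function (\<lambda>t. integral {0..t} f)"
      by (rule orlicz_function_integral[OF f_mono _ f_pos]) (simp add: f_def)
    show "regularly_varying_at_infinity (\<lambda>t. integral {0..t} f)"
      by (rule regularly_varying_integral[OF f_mono f_pos f_cont f_lim])
    show "orlicz_equivalent F (\<lambda>t. integral {0..t} f)"
    proof (rule orlicz_equivalent_integral[OF F f_mono, of "exp (2 * K)"])
      fix t :: real assume t: "0 < t"
      show "F t / exp (2 * K) \<le> t * f t"
        unfolding F_eq[OF t] tf_eq[OF t] exp_diff[symmetric] using near[of "ln t"] by simp
      show "t * f t \<le> exp (2 * K) * F t"
        unfolding F_eq[OF t] tf_eq[OF t] exp_add[symmetric] using near[of "ln t"] by simp
    qed (use K0 in \<open>simp_all add: f_def\<close>)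
  qed
qed

end
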